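(* For every integer $n\geq 0$, in the Tower of Hanoi-Fibonacci with $n$ disks there is a finite sequence of Fibonacci moves leading from the state $(\Delta_n,\varnothing,\varnothing)$ to the state $(\varnothing,\varnothing,\Delta_n)$. The minimal number of Fibonacci moves in such a sequence is exactly $F_{n+2}-1$ (so a minimal solution passes through $F_{n+2}$ distinct states), and there is exactly one sequence of moves achieving this minimum.
   Context: Fibonacci numbers: $F_1=F_2=1$, $F_{m+2}=F_{m+1}+F_m$. Disks are labelled $1,\dots,n$ by radius; $\Delta_k=\{1,\dots,k\}$ (and $\Delta_k=\varnothing$ for $k<1$). A state is an ordered triple $(A,B,C)$ of pairwise disjoint sets with union $\Delta_n$ (pegs $A,B,C$; each peg holds its disks in decreasing order from bottom to top, so the top disk of a peg is its minimum). For a set $S$ of disks and a disk $k$, writing $kS$ (or $\Delta_{k-1}S$) means the peg contains $k$ (resp. $\Delta_{k-1}$) together with $S$, all elements of $S$ being larger. For $k\in\Delta_n$, a $k$-Fibonacci move is defined when two distinct pegs $X,Y$ satisfy $X=k\tilde X$ and $Y=\Delta_{k-1}\tilde Y$ (with all disks of $\tilde X,\tilde Y$ larger than $k$) and the third peg $Z$ contains only disks larger than $k$; it puts both disks $k-1$ and $k$ simultaneously onto $Z$: $k\tilde{X}\sqcup \Delta_{k-1}\tilde{Y}\sqcup Z\longrightarrow \tilde{X}\sqcup \Delta_{k-2}\tilde{Y}\sqcup (k-1)kZ$ (positions of pegs preserved). For $k=1$ this just moves disk $1$ to another peg. A Fibonacci move is a $k$-Fibonacci move for some $k$; the Tower of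 Hanoi-Fibonacci is the puzzle where only Fibonacci moves are allowed. *)

theory Defs
  imports Main "HOL-Number_Theory.Fib"
begin

datatype peg = PegA | PegB | PegC

text \<open>A configuration is the ordered triple of the sets of disks lying on the three pegs,
  indexed by peg. The order of the disks on a peg is determined by their radii.\<close>

type_synonym config = "peg \<Rightarrow> nat set"

definition triple :: "nat set \<Rightarrow> nat set \<Rightarrow> nat set \<Rightarrow> config" where
  "triple P Q R = (\<lambda>p. case p of PegA \<Rightarrow> P | PegB \<Rightarrow> Q | PegC \<Rightarrow> R)"

definition disks :: "nat \<Rightarrow> nat set" where
  "disks k = {1..k}"

definition is_state :: "nat \<Rightarrow> config \<Rightarrow> bool" where
  "is_state n s \<longleftrightarrow> (\<forall>p q. p \<noteq> q \<longrightarrow> s p \<inter> s q = {}) \<and> (\<Union>p. s p) = disks n"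

text \<open>The move labelled \<open>(k, X, Y, Z)\<close> is the \<open>k\<close>-Fibonacci move taking disk \<open>k\<close> from peg \<open>X\<close>
  and disk \<open>k - 1\<close> from peg \<open>Y\<close> onto the third peg \<open>Z\<close>. For \<open>k = 1\<close> there is no disk
  \<open>k - 1\<close> (disks are numbered from 1), so \<open>0\<close> is removed from the set of moved disks; the truncated
  \<open>k - 2 = 0\<close> then correctly gives the empty set \<open>disks (k - 2)\<close>.\<close>

type_synonym move = "nat \<times> peg \<times> peg \<times> peg"

inductive fib_move :: "nat \<Rightarrow> move \<Rightarrow> config \<Rightarrow> config \<Rightarrow> bool" for n :: nat where
  "fib_move n (k, X, Y, Z) s
     (s(X := X', Y := disks (k - 2) \<union> Y', Z := ({k - 1, k} - {0}) \<union> s Z))"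
  if "is_state n s"
    and "k \<in> disks n"
    and "distinct [X, Y, Z]"
    and "s X = insert k X'" and "\<forall>d\<in>X'. k < d"
    and "s Y = disks (k - 1) \<union> Y'" and "\<forall>d\<in>Y'. k < d"
    and "\<forall>d\<in>s Z. k < d"

text \<open>\<open>ms\<close> is the sequence of moves, \<open>ss\<close> the sequence of all states passed through, including
  the initial and the final one.\<close>

definition is_solution :: "nat \<Rightarrow> move list \<Rightarrow> config list \<Rightarrow> bool" where
  "is_solution n ms ss \<longleftrightarrow>
     length ss = Suc (length ms) \<and>
     hd ss = triple (disks n) {} {} \<and>
     last ss = triple {} {} (disks n) \<and>
     (\<forall>i<length ms. fib_move n (ms ! i) (ss ! i) (ss ! Suc i))"

definition is_minimal_solution :: "nat \<Rightarrow> move list \<Rightarrow> config list \<Rightarrow> bool" where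
  "is_minimal_solution n ms ss \<longleftrightarrow>
     is_solution n ms ss \<and> (\<forall>ms' ss'. is_solution n ms' ss' \<longrightarrow> length ms \<le> length ms')"

lemma is_state_fib_move:
  assumes "fib_move n m s t"
  shows "is_state n t"
  using assms
proof cases
  case (1 k X Y Z X' Y')
  have U: "(UNIV :: peg set) = {X, Y, Z}"
    using 1(5) by (auto simp: UNIV_eq_I) (metis peg.exhaust)
  have P: "(\<forall>p. Q p) \<longleftrightarrow> Q X \<and> Q Y \<and> Q Z" for Q
    using U by (metis UNIV_I insertE singletonD)
  have N: "X \<noteq> Y" "X \<noteq> Z" "Y \<noteq> Z" "Y \<noteq> X" "Z \<noteq> X" "Z \<noteq> Y"
    using 1(5) by auto
  have D: "X' \<inter> Y' = {}" "X' \<inter> s Z = {}" "Y' \<inter> s Z = {}"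
    using 1(3,6,8) N unfolding is_state_def by blast+
  have E: "insert k X' \<union> (disks (k - 1) \<union> Y') \<union> s Z = disks n"
    using 1(3,6,8) unfolding is_state_def U by auto
  have F: "insert k (disks (k - 1)) = disks (k - 2) \<union> ({k - 1, k} - {0})"
    using 1(4) by (auto simp: disks_def)
  have G: "disks (k - 2) \<inter> ({k - 1, k} - {0}) = {}"
    using 1(4) by (auto simp: disks_def)
  have H: "d \<in> disks (k - 2) \<Longrightarrow> d \<le> k" "d \<in> {k - 1, k} - {0} \<Longrightarrow> d \<le> k" for d
    by (auto simp: disks_def)
  have "(\<Union>p. t p) = X' \<union> (disks (k - 2) \<union> Y') \<union> (({k - 1, k} - {0}) \<union> s Z)"
    unfolding U 1(2) using N by auto
  also have "\<dots> = disks n"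
    using E F by blast
  finally have "(\<Union>p. t p) = disks n" .
  moreover have "X' \<inter> (disks (k - 2) \<union> Y') = {}"
    "X' \<inter> (({k - 1, k} - {0}) \<union> s Z) = {}"
    "(disks (k - 2) \<union> Y') \<inter> (({k - 1, k} - {0}) \<union> s Z) = {}"
    using D G H 1(7,9,10) by (auto simp del: Diff_iff simp: disjoint_iff) (metis leD)+
  ultimately show ?thesis
    unfolding is_state_def P 1(2) using N by (auto simp del: Diff_iff)
qed

end

theory Submission
  imports Defs
begin

text \<open>Let \<open>T m\<close> be the least number of moves taking a tower of \<open>m\<close> disks from one peg to another.
  Before disk \<open>m\<close> first moves, the tower of the \<open>m - 1\<close> smaller disks has to be moved, and after its
  last move the disks \<open>1, \<dots>, m - 2\<close> form a tower and disk \<open>m - 1\<close> already is on the goal peg. It does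
  not pay to move disk \<open>m - 1\<close> again: unless the tower of \<open>m - 2\<close> disks is moved first, it takes at
  least two moves of disk \<open>m - 1\<close>, and disk \<open>m - 2\<close> has to be moved between them. Hence
  \<open>T m = T (m - 1) + 1 + T (m - 2)\<close>. The bounds are proved by a simultaneous
  induction, which also shows that equality forces the recursive strategy.\<close>

section \<open>Peg functions as states, and the recursive strategy\<close>

text \<open>A state is described by the function giving the peg of each disk. The value at \<open>0\<close>, which is
  not a disk, is arbitrary and never changes.\<close>

fun legal :: "move \<Rightarrow> (nat \<Rightarrow> peg) \<Rightarrow> bool" where
  "legal (k, X, Y, Z) f \<longleftrightarrow> 0 < k \<and> distinct [X, Y, Z] \<and> f k = X \<and> (\<forall>d\<in>{1..<k}. f d = Y)"

fun place :: "move \<Rightarrow> (nat \<Rightarrow> peg) \<Rightarrow> nat \<Rightarrow> peg" where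
  "place (k, X, Y, Z) f = (\<lambda>d. if d \<in> {k - 1, k} - {0} then Z else f d)"

primrec play :: "nat \<Rightarrow> move list \<Rightarrow> (nat \<Rightarrow> peg) \<Rightarrow> (nat \<Rightarrow> peg) \<Rightarrow> bool" where
  "play m [] f g \<longleftrightarrow> f = g"
| "play m (mv # ms) f g \<longleftrightarrow> fst mv \<le> m \<and> legal mv f \<and> play m ms (place mv f) g"

definition tower :: "nat \<Rightarrow> peg \<Rightarrow> (nat \<Rightarrow> peg) \<Rightarrow> bool" where
  "tower m X f \<longleftrightarrow> (\<forall>d\<in>{1..m}. f d = X)"

text \<open>For \<open>X = Z\<close> no such peg exists and the value is unspecified.\<close>

definition third :: "peg \<Rightarrow> peg \<Rightarrow> peg" where
  "third X Z = (THE Y. distinct [X, Y, Z])"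

lemma third_cases:
  fixes X Y Z W :: peg
  shows "distinct [X, Y, Z] \<Longrightarrow> W = X \<or> W = Y \<or> W = Z"
  by (cases X; cases Y; cases Z; cases W) auto

lemma third_eq: "distinct [X, Y, Z] \<Longrightarrow> third X Z = Y"
  unfolding third_def
  by (rule the_equality) (use third_cases in force)+

lemma distinct_third:
  assumes "X \<noteq> Z"
  shows "distinct [X, third X Z, Z]"
proof -
  obtain Y where "distinct [X, Y, Z]"
    using assms by (cases X; cases Z) auto
  then show ?thesis
    using third_eq by metis
qed

text \<open>The last call has \<open>m - 1\<close> instead of \<open>m\<close> because the move of
  disk \<open>Suc m\<close> has already brought disk \<open>m\<close> to \<open>Z\<close>. For
  \<open>m = 0\<close> truncation makes this call empty.\<close>

fun sol :: "nat \<Rightarrow> peg \<Rightarrow> peg \<Rightarrow> move list" where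
  "sol 0 X Z = []"
| "sol (Suc m) X Z =
    sol m X (third X Z) @ (Suc m, X, third X Z, Z) # sol (m - 1) (third X Z) Z"

lemma play_append: "play m (xs @ ys) f g \<longleftrightarrow> (\<exists>h. play m xs f h \<and> play m ys h g)"
  by (induction xs arbitrary: f) auto

lemma play_mono: "play m ms f g \<Longrightarrow> m \<le> n \<Longrightarrow> play n ms f g"
  by (induction ms arbitrary: f) auto

lemma play_fixes: "play m ms f g \<Longrightarrow> m < d \<Longrightarrow> g d = f d"
proof (induction ms arbitrary: f)
  case (Cons mv ms)
  then show ?case by (cases mv) auto
qed simp

lemma tower_Suc: "tower (Suc m) X f \<longleftrightarrow> tower m X f \<and> f (Suc m) = X"
  by (auto simp: tower_def atLeastAtMostSuc_conv)

lemma legal_Suc: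
  "legal (Suc m, X, Y, Z) f \<longleftrightarrow> distinct [X, Y, Z] \<and> f (Suc m) = X \<and> tower m Y f"
  by (auto simp: tower_def)

lemma length_sol: "length (sol m X Z) + 1 = fib (m + 2)"
proof (induction m X Z rule: sol.induct)
  case (2 m X Z)
  then show ?case by (cases m) (auto simp: numeral_eq_Suc)
qed (simp add: numeral_eq_Suc)

text \<open>Giving the final function explicitly records that larger disks stay put, so the plays of
  the three phases can be glued.\<close>

lemma play_sol:
  "X \<noteq> Z \<Longrightarrow> tower m X f \<Longrightarrow> play m (sol m X Z) f (\<lambda>d. if d \<in> {1..m} then Z else f d)"
proof (induction m X Z arbitrary: f rule: sol.induct)
  case (1 X Z)
  then show ?case by simp
next
  case (2 m X Z)
  define Y where "Y = third X Z"
  have d: "distinct [X, Y, Z]"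
    using distinct_third 2 Y_def by simp
  define h where "h = (\<lambda>d. if d \<in> {1..m} then Y else f d)"
  define h' where "h' = place (Suc m, X, Y, Z) h"
  define e where "e = (\<lambda>d. if d \<in> {1..m - 1} then Z else h' d)"
  have 1: "play m (sol m X Y) f h"
    using "2.IH"(1)[of f] 2(4) d unfolding h_def Y_def tower_Suc by simp
  have 2: "legal (Suc m, X, Y, Z) h"
    using d 2(4) by (simp add: legal_Suc tower_Suc h_def tower_def)
  have "tower (m - 1) Y h'"
    by (auto simp: tower_def h'_def h_def)
  then have 3: "play (m - 1) (sol (m - 1) Y Z) h' e"
    using "2.IH"(2) d unfolding e_def by (simp add: Y_def)
  have "e = (\<lambda>d. if d \<in> {1..Suc m} then Z else f d)"
    by (auto simp: e_def h'_def h_def fun_eq_iff)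
  then show ?case
    using play_mono[OF 1, of "Suc m"] 2 play_mono[OF 3, of "Suc m"]
    by (auto simp: play_append Y_def[symmetric] h'_def simp del: place.simps legal.simps)
qed

text \<open>Given a play with bound \<open>Suc m\<close>, failure of \<open>play m\<close> says
  precisely that some move has label \<open>Suc m\<close>. Cutting at the first such move leaves a
  prefix that cannot touch disk \<open>Suc m\<close>, so this disk still stands where
  \<open>f\<close> put it.\<close>

lemma first_largest_move:
  assumes "play (Suc m) ms f g" "\<not> play m ms f g"
  obtains as X Y Z bs h where "ms = as @ (Suc m, X, Y, Z) # bs" "play m as f h"
    "distinct [X, Y, Z]" "f (Suc m) = X" "tower m Y h"
    "play (Suc m) ((Suc m, X, Y, Z) # bs) h g"
proof -
  have "\<exists>as mv bs h. ms = as @ mv # bs \<and> fst mv = Suc m \<and> play m as f h \<and>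
      play (Suc m) (mv # bs) h g"
    using assms
  proof (induction ms arbitrary: f)
    case (Cons mv ms)
    show ?case
    proof (cases "fst mv = Suc m")
      case True
      then show ?thesis
        using Cons.prems by (intro exI[of _ "[]"]) auto
    next
      case False
      then have "fst mv \<le> m" "legal mv f" "play (Suc m) ms (place mv f) g"
        "\<not> play m ms (place mv f) g"
        using Cons.prems by auto
      with Cons.IH obtain as mv' bs h where "ms = as @ mv' # bs" "fst mv' = Suc m"
        "play m as (place mv f) h" "play (Suc m) (mv' # bs) h g"
        by blast
      with \<open>fst mv \<le> m\<close> \<open>legal mv f\<close> show ?thesis
        by (intro exI[of _ "mv # as"]) auto
    qed
  qed simp
  then obtain as X Y Z bs h where *: "ms = as @ (Suc m, X, Y, Z) # bs" "play m as f h"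
    "play (Suc m) ((Suc m, X, Y, Z) # bs) h g"
    by (metis prod.collapse)
  from *(3) have "legal (Suc m, X, Y, Z) h"
    by simp
  with * that play_fixes[OF *(2), of "Suc m"] show thesis
    unfolding legal_Suc by simp
qed

section \<open>Lower bounds with uniqueness\<close>

definition tower_bound :: "nat \<Rightarrow> bool" where
  "tower_bound m \<longleftrightarrow> (\<forall>ms f g X Z.
     play m ms f g \<longrightarrow> tower m X f \<longrightarrow> tower m Z g \<longrightarrow> X \<noteq> Z \<longrightarrow>
     fib (m + 2) \<le> length ms + 1 \<and> (length ms + 1 = fib (m + 2) \<longrightarrow> ms = sol m X Z))"

text \<open>The situation after the last move of disk \<open>m + 1\<close>.\<close>

definition rest_bound :: "nat \<Rightarrow> bool" where
  "rest_bound m \<longleftrightarrow> (\<forall>ms f g Y Z.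
     play m ms f g \<longrightarrow> (\<forall>d\<in>{1..m}. f d = (if d = m then Z else Y)) \<longrightarrow> tower m Z g \<longrightarrow> Y \<noteq> Z \<longrightarrow>
     fib (m + 1) \<le> length ms + 1 \<and> (length ms + 1 = fib (m + 1) \<longrightarrow> ms = sol (m - 1) Y Z))"

text \<open>The move leaves disks below \<open>m\<close> on \<open>Y\<close> and puts disk
  \<open>m\<close> on \<open>Z\<close>, which is the start considered in \<open>rest_bound\<close>.
  Since \<open>ms\<close> contains no further move of disk \<open>Suc m\<close>, the goal peg must
  be \<open>Z\<close>.\<close>

lemma rest_bound_after_move:
  assumes "rest_bound m" "legal (Suc m, X, Y, Z) h" "tower (Suc m) W g"
    "play m ms (place (Suc m, X, Y, Z) h) g"
  shows "fib (m + 1) \<le> length ms + 1"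
    and "length ms + 1 = fib (m + 1) \<Longrightarrow> ms = sol (m - 1) Y Z"
    and "W = Z"
proof -
  show "W = Z"
    using play_fixes[OF assms(4), of "Suc m"] assms(3) by (simp add: tower_Suc)
  moreover have "\<forall>d\<in>{1..m}. place (Suc m, X, Y, Z) h d = (if d = m then Z else Y)"
    using assms(2) by (auto simp: legal_Suc tower_def simp del: legal.simps)
  moreover have "Y \<noteq> Z" "tower m W g"
    using assms(2,3) by (auto simp: tower_Suc)
  ultimately have "fib (m + 1) \<le> length ms + 1 \<and> (length ms + 1 = fib (m + 1) \<longrightarrow> ms = sol (m - 1) Y Z)"
    using assms(1,4) unfolding rest_bound_def by blast
  then show "fib (m + 1) \<le> length ms + 1"
    and "length ms + 1 = fib (m + 1) \<Longrightarrow> ms = sol (m - 1) Y Z"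
    by auto
qed

text \<open>Count the last move of disk \<open>Suc m\<close> and, by \<open>rest_bound\<close>, at
  least \<open>fib (Suc m) - 1\<close> moves after it. The starting state does not matter, which
  makes the bound applicable in the middle of a play.\<close>

lemma largest_move_bound:
  assumes "rest_bound m" "play (Suc m) ms f g" "\<not> play m ms f g" "tower (Suc m) Z g"
  shows "fib (Suc m) \<le> length ms"
  using assms(2,3)
proof (induction ms arbitrary: f)
  case (Cons mv ms)
  show ?case
  proof (cases "play m ms (place mv f) g")
    case True
    \<comment> \<open>Nothing after \<open>mv\<close> has label \<open>Suc m\<close>, so
      \<open>mv\<close> is the last move of the largest disk.\<close>
    then have "fst mv = Suc m"
      using Cons.prems by auto
    then obtain X Y W where mv: "mv = (Suc m, X, Y, W)"
      by (metis prod.collapse)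
    moreover have "legal mv f"
      using Cons.prems(1) by simp
    ultimately show ?thesis
      using rest_bound_after_move(1)[OF assms(1) _ assms(4)] True by (simp del: legal.simps place.simps)
  next
    case False
    then show ?thesis
      using Cons by fastforce
  qed
qed simp

lemma tower_bound_Suc:
  assumes T: "tower_bound m" and R: "rest_bound m"
  shows "tower_bound (Suc m)"
  unfolding tower_bound_def
proof (intro allI impI)
  fix ms f g X Z
  assume *: "play (Suc m) ms f g" "tower (Suc m) X f" "tower (Suc m) Z g" "X \<noteq> Z"
  then have "\<not> play m ms f g"
    using play_fixes[of m ms f g "Suc m"] by (auto simp: tower_Suc)
  then obtain as Y W bs h where ms: "ms = as @ (Suc m, X, Y, W) # bs" and as: "play m as f h"
    and d: "distinct [X, Y, W]" and h: "tower m Y h"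
    and bs: "play (Suc m) ((Suc m, X, Y, W) # bs) h g"
    using first_largest_move *(1,2) unfolding tower_Suc by metis
  have 1: "fib (m + 2) \<le> length as + 1" "length as + 1 = fib (m + 2) \<Longrightarrow> as = sol m X Y"
    using T as h d *(2) unfolding tower_bound_def tower_Suc by auto
  show "fib (Suc m + 2) \<le> length ms + 1 \<and> (length ms + 1 = fib (Suc m + 2) \<longrightarrow> ms = sol (Suc m) X Z)"
  proof (cases "play m bs (place (Suc m, X, Y, W) h) g")
    case True
    note 2 = rest_bound_after_move[OF R _ *(3) True]
    have "legal (Suc m, X, Y, W) h"
      using bs by simp
    note 2 = 2[OF this]
    \<comment> \<open>As \<open>W = Z\<close>, the intermediate peg is forced, and the optimal
      pieces \<open>as\<close> and \<open>bs\<close> compose to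
      \<open>sol (Suc m) X Z\<close>.\<close>
    have "third X Z = Y"
      using d 2(3) third_eq by blast
    then show ?thesis
      using 1 2 by (auto simp: ms)
  next
    case False
    \<comment> \<open>Moving disk \<open>Suc m\<close> again costs at least one move more than
      \<open>rest_bound\<close> requires, so equality is impossible here.\<close>
    then have "fib (Suc m) \<le> length bs"
      using largest_move_bound[OF R _ False *(3)] bs by simp
    then show ?thesis
      using 1 by (auto simp: ms)
  qed
qed

text \<open>If disk \<open>Suc m\<close> stays on \<open>Z\<close>, only the tower of
  \<open>m\<close> disks moves. Otherwise the count is strictly larger: either that tower changes
  pegs before disk \<open>Suc m\<close> moves, or disk \<open>Suc m\<close> leaves \<open>Z\<close>
  and has to return, with a move of disk \<open>m\<close> forced in between. This forced move uses
  the bound two levels down, \<open>R'\<close>.\<close>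

lemma rest_bound_Suc:
  assumes T: "tower_bound m" and R: "rest_bound m" and R': "\<And>j. m = Suc j \<Longrightarrow> rest_bound j"
  shows "rest_bound (Suc m)"
  unfolding rest_bound_def
proof (intro allI impI)
  fix ms f g Y Z
  assume *: "play (Suc m) ms f g" "\<forall>d\<in>{1..Suc m}. f d = (if d = Suc m then Z else Y)"
    "tower (Suc m) Z g" "Y \<noteq> Z"
  have f: "tower m Y f" "f (Suc m) = Z"
    using *(2) by (auto simp: tower_def)
  have g: "tower m Z g" "g (Suc m) = Z"
    using *(3) by (auto simp: tower_Suc)
  show "fib (Suc m + 1) \<le> length ms + 1 \<and>
    (length ms + 1 = fib (Suc m + 1) \<longrightarrow> ms = sol (Suc m - 1) Y Z)"
  proof (cases "play m ms f g")
    case True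
    then show ?thesis
      using T f g *(4) unfolding tower_bound_def by auto
  next
    case False
    then obtain as V W bs h where ms: "ms = as @ (Suc m, Z, V, W) # bs" and as: "play m as f h"
      and d: "distinct [Z, V, W]" and h: "tower m V h"
      and bs: "play (Suc m) ((Suc m, Z, V, W) # bs) h g"
      using first_largest_move *(1) f(2) by metis
    show ?thesis
    proof (cases "V = Y")
      case False
      then have "fib (m + 2) \<le> length as + 1"
        using T as f h unfolding tower_bound_def by auto
      then show ?thesis
        by (simp add: ms)
    next
      case True
      define h' where "h' = place (Suc m, Z, V, W) h"
      have h': "h' (Suc m) = W" "play (Suc m) bs h' g"
        using bs by (simp_all add: h'_def)
      then have "\<not> play m bs h' g"
        using play_fixes[of m bs h' g "Suc m"] g d by auto
      then obtain es V' W' ds e where bs_eq: "bs = es @ (Suc m, W, V', W') # ds"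
        and es: "play m es h' e" and d': "distinct [W, V', W']" and e: "tower m V' e"
        and ds: "play (Suc m) ((Suc m, W, V', W') # ds) e g"
        using first_largest_move h' by metis
      \<comment> \<open>The bound is applied to the tail starting with the second move of disk
        \<open>Suc m\<close>, hence the \<open>+ 1\<close> below.\<close>
      have "\<not> play m ((Suc m, W, V', W') # ds) e g"
        by simp
      from largest_move_bound[OF R ds this *(3)]
      have 1: "fib (Suc m) \<le> length ds + 1"
        by simp
      \<comment> \<open>The first move brought disk \<open>m\<close> to \<open>W\<close> along with
        disk \<open>Suc m\<close>; before the second it must have joined the tower on
        \<open>V'\<close>. For \<open>m = 0\<close> there is no such disk, but
        \<open>fib 0 = 0\<close>.\<close>
      have 2: "fib m \<le> length es"
      proof (cases m)
        case (Suc j)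
        then have "h' m = W" "e m = V'"
          using e by (simp_all add: h'_def tower_Suc)
        then have "\<not> play j es h' e"
          using play_fixes[of j es h' e m] d' Suc by auto
        then show ?thesis
          using largest_move_bound[OF R'[OF Suc]] es e Suc by auto
      qed simp
      show ?thesis
        using 1 2 by (simp add: ms bs_eq)
    qed
  qed
qed

lemma tower_bound_rest_bound: "tower_bound m \<and> rest_bound m"
\<comment> \<open>Strong induction supplies the two preceding levels needed by
  \<open>rest_bound_Suc\<close>.\<close>
proof (induction m rule: less_induct)
  case (less m)
  show ?case
  proof (cases m)
    case 0
    then show ?thesis
      by (auto simp: tower_bound_def rest_bound_def numeral_eq_Suc)
  next
    case (Suc j)
    then show ?thesis
      using less tower_bound_Suc rest_bound_Suc by (metis lessI less_SucI)
  qed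
qed

section \<open>Transfer to configurations\<close>

definition conf :: "nat \<Rightarrow> (nat \<Rightarrow> peg) \<Rightarrow> config" where
  "conf n f = (\<lambda>p. {d \<in> disks n. f d = p})"

lemma is_state_conf: "is_state n (conf n f)"
  by (auto simp: is_state_def conf_def)

lemma conf_place:
  assumes "legal (k, X, Y, Z) f" "k \<le> n"
  shows "conf n (place (k, X, Y, Z) f) =
    (conf n f)(X := conf n f X - {k}, Y := disks (k - 2) \<union> (conf n f Y - disks (k - 1)),
      Z := ({k - 1, k} - {0}) \<union> conf n f Z)"
proof (intro ext set_eqI)
  fix p d
  have k: "0 < k" "X \<noteq> Y" "X \<noteq> Z" "Y \<noteq> Z" "f k = X" and Y: "0 < d \<Longrightarrow> d < k \<Longrightarrow> f d = Y"
    using assms(1) by auto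
  consider "d = 0" | "0 < d" "d < k - 1" | "0 < d" "d = k - 1" | "d = k" | "k < d"
    using k(1) by linarith
  then show "d \<in> conf n (place (k, X, Y, Z) f) p \<longleftrightarrow>
    d \<in> ((conf n f)(X := conf n f X - {k}, Y := disks (k - 2) \<union> (conf n f Y - disks (k - 1)),
      Z := ({k - 1, k} - {0}) \<union> conf n f Z)) p"
    by cases (use k Y assms(2) in \<open>auto simp: conf_def disks_def\<close>)
qed

text \<open>Legality fixes the pegs of all disks up to \<open>k\<close>, and none of them is on
  \<open>Z\<close>; so the size conditions on all three pegs follow.\<close>

lemma fib_move_conf_iff:
  "fib_move n mv (conf n f) t \<longleftrightarrow> fst mv \<le> n \<and> legal mv f \<and> t = conf n (place mv f)"
proof -
  obtain k X Y Z where mv: "mv = (k, X, Y, Z)"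
    by (metis prod.collapse)
  show ?thesis
  proof
    assume "fib_move n mv (conf n f) t"
    then show "fst mv \<le> n \<and> legal mv f \<and> t = conf n (place mv f)"
    proof cases
      case (1 k X Y Z X' Y')
      have k: "0 < k" "k \<le> n"
        using 1(4) by (auto simp: disks_def)
      have "k \<in> conf n f X"
        using 1(6) by simp
      then have X: "f k = X"
        by (simp add: conf_def)
      have "d \<in> conf n f Y" if "d \<in> {1..<k}" for d
        using 1(8) that by (auto simp: disks_def)
      then have Y: "f d = Y" if "d \<in> {1..<k}" for d
        using that by (simp add: conf_def)
      have legal: "legal mv f"
        using k X Y 1(1,5) by simp
      \<comment> \<open>All remaining disks exceed \<open>k\<close>, so the decompositions of the
        two pegs determine \<open>X'\<close> and \<open>Y'\<close>.\<close>
      have X': "X' = conf n f X - {k}" and Y': "Y' = conf n f Y - disks (k - 1)"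
        using 1(6-9) by (auto simp: disks_def)
      show ?thesis
        using legal k conf_place[of k X Y Z f n] unfolding 1(1,2) X' Y' by simp
    qed
  next
    assume a: "fst mv \<le> n \<and> legal mv f \<and> t = conf n (place mv f)"
    define X' Y' where "X' = conf n f X - {k}" and "Y' = conf n f Y - disks (k - 1)"
    have k: "0 < k" "k \<le> n" and d: "distinct [X, Y, Z]" and X: "f k = X"
      and Y: "\<And>d. d \<in> {1..<k} \<Longrightarrow> f d = Y"
      using a mv by auto
    have gt: "k < e" if "e \<in> disks n" "f e \<noteq> Y" "e \<noteq> k" for e
      using Y[of e] that by (cases "e < k") (auto simp: disks_def)
    have gt': "k < e" if "e \<in> disks n" "f e = Y" "e \<notin> disks (k - 1)" for e
      using that k X d by (cases "e = k") (auto simp: disks_def)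
    have t: "t = (conf n f)(X := X', Y := disks (k - 2) \<union> Y',
        Z := ({k - 1, k} - {0}) \<union> conf n f Z)"
      using a conf_place[of k X Y Z f n] unfolding mv X'_def Y'_def by simp
    show "fib_move n mv (conf n f) t"
      unfolding mv t
    proof (rule fib_move.intros)
      show "k \<in> disks n" using k by (simp add: disks_def)
      show "conf n f X = insert k X'" using k X by (auto simp: X'_def conf_def disks_def)
      show "conf n f Y = disks (k - 1) \<union> Y'" using k Y by (auto simp: Y'_def conf_def disks_def)
      show "\<forall>e\<in>X'. k < e" using gt d by (auto simp: X'_def conf_def)
      show "\<forall>e\<in>Y'. k < e" using gt' by (auto simp: Y'_def conf_def)
      show "\<forall>e\<in>conf n f Z. k < e" using gt d X by (auto simp: conf_def)
    qed (fact is_state_conf d)+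
  qed
qed

lemma play_imp_moves:
  "play n ms f g \<Longrightarrow> \<exists>ss. length ss = Suc (length ms) \<and> hd ss = conf n f \<and> last ss = conf n g \<and>
     (\<forall>i<length ms. fib_move n (ms ! i) (ss ! i) (ss ! Suc i))"
proof (induction ms arbitrary: f)
  case Nil
  then show ?case by (intro exI[of _ "[conf n f]"]) simp
next
  case (Cons mv ms)
  then obtain ss where ss: "length ss = Suc (length ms)" "hd ss = conf n (place mv f)"
    "last ss = conf n g" "\<forall>i<length ms. fib_move n (ms ! i) (ss ! i) (ss ! Suc i)"
    by fastforce
  then have "ss \<noteq> []" by auto
  have "fib_move n mv (conf n f) (ss ! 0)"
    using Cons.prems ss(2) \<open>ss \<noteq> []\<close> by (simp add: fib_move_conf_iff flip: hd_conv_nth)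
  then show ?case
    using ss \<open>ss \<noteq> []\<close> by (intro exI[of _ "conf n f # ss"]) (auto simp: nth_Cons split: nat.split)
qed

text \<open>Only the first state is assumed to come from a peg function;
  \<open>fib_move_conf_iff\<close> passes this on along the moves.\<close>

lemma moves_imp_play:
  assumes "length ss = Suc (length ms)" "hd ss = conf n f"
    "\<forall>i<length ms. fib_move n (ms ! i) (ss ! i) (ss ! Suc i)"
  shows "\<exists>g. play n ms f g \<and> last ss = conf n g"
  using assms
proof (induction ms arbitrary: f ss)
  case Nil
  then show ?case by (cases ss) auto
next
  case (Cons mv ms)
  then obtain s ss' where ss: "ss = s # ss'" "length ss' = Suc (length ms)"
    by (cases ss) auto
  then have "ss' \<noteq> []" by auto
  have "fib_move n mv (conf n f) (hd ss')"
    using Cons.prems ss \<open>ss' \<noteq> []\<close> by (force simp: hd_conv_nth)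
  moreover have "\<forall>i<length ms. fib_move n (ms ! i) (ss' ! i) (ss' ! Suc i)"
    using Cons.prems(3) ss(1) by fastforce
  ultimately show ?case
    using Cons.IH[OF ss(2)] ss \<open>ss' \<noteq> []\<close> by (auto simp: fib_move_conf_iff)
qed

lemma conf_eq_triple_A: "conf n (\<lambda>_. PegA) = triple (disks n) {} {}"
  by (auto simp: conf_def triple_def fun_eq_iff split: peg.split)

lemma conf_eq_triple_C: "conf n g = triple {} {} (disks n) \<longleftrightarrow> tower n PegC g"
  by (auto simp: conf_def triple_def tower_def disks_def fun_eq_iff split: peg.split)

lemma is_solution_iff_play:
  "(\<exists>ss. is_solution n ms ss) \<longleftrightarrow> (\<exists>g. play n ms (\<lambda>_. PegA) g \<and> tower n PegC g)"
  unfolding is_solution_def conf_eq_triple_A[symmetric]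
  using play_imp_moves moves_imp_play conf_eq_triple_C by metis

text \<open>Cutting out the moves between two occurrences of the same state would give a shorter
  solution.\<close>

lemma distinct_minimal_solution:
  assumes "is_minimal_solution n ms ss"
  shows "distinct ss"
proof (rule ccontr)
  assume "\<not> distinct ss"
  then obtain i j where ij: "i < j" "j < length ss" "ss ! i = ss ! j"
    by (metis distinct_conv_nth linorder_neqE_nat)
  have sol: "is_solution n ms ss"
    using assms by (simp add: is_minimal_solution_def)
  then have len: "length ss = Suc (length ms)"
    and mv: "\<And>l. l < length ms \<Longrightarrow> fib_move n (ms ! l) (ss ! l) (ss ! Suc l)"
    by (auto simp: is_solution_def)
  define ms' ss' where "ms' = take i ms @ drop j ms" and "ss' = take i ss @ drop j ss"
  have ms': "ms' ! l = ms ! (if l < i then l else l - i + j)" if "l < length ms'" for l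
    using that ij len by (auto simp: ms'_def nth_append add.commute)
  \<comment> \<open>At position \<open>i\<close> the shortened list holds \<open>ss ! j\<close>,
    which equals \<open>ss ! i\<close>; hence \<open>l \<le> i\<close> here but \<open>l < i\<close>
    for the moves.\<close>
  have ss': "ss' ! l = ss ! (if l \<le> i then l else l - i + j)" if "l < length ss'" for l
    using that ij len by (auto simp: ss'_def nth_append add.commute)
  have len': "length ms' = length ms - (j - i)" "length ss' = Suc (length ms')"
    using ij len by (auto simp: ms'_def ss'_def)
  have "hd ss' = hd ss"
    using ij len ss'[of 0] by (simp add: hd_conv_nth flip: length_greater_0_conv add: len')
  moreover have "last ss' = last ss"
    using ij by (simp add: ss'_def)
  moreover have "fib_move n (ms' ! l) (ss' ! l) (ss' ! Suc l)" if "l < length ms'" for l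
  proof (cases "l < i")
    case True
    then show ?thesis
      using that ms'[of l] ss'[of l] ss'[of "Suc l"] mv[of l] len' by simp
  next
    case False
    then have "ss' ! l = ss ! (l - i + j)" "Suc l - i + j = Suc (l - i + j)"
      using that ss'[of l] len' ij by (auto simp: le_less)
    then show ?thesis
      using False that ms'[of l] ss'[of "Suc l"] mv[of "l - i + j"] len' by simp
  qed
  ultimately have "is_solution n ms' ss'"
    using sol len' by (simp add: is_solution_def)
  then have "length ms \<le> length ms'"
    using assms unfolding is_minimal_solution_def by blast
  then show False
    using len' ij len by simp
qed

theorem theorem2p2:
  fixes n :: nat
  shows "(\<exists>ms ss. is_solution n ms ss) \<and>
    (\<forall>ms ss. is_minimal_solution n ms ss \<longrightarrow>
       length ms = fib (n + 2) - 1 \<and> card (set ss) = fib (n + 2)) \<and>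
    (\<exists>!ms. \<exists>ss. is_minimal_solution n ms ss)"
proof -
  define opt where "opt = sol n PegA PegC"
  have "\<exists>ss. is_solution n opt ss"
    unfolding is_solution_iff_play opt_def
    using play_sol[of PegA PegC n "\<lambda>_. PegA"] by (force simp: tower_def)
  then obtain ss0 where ss0: "is_solution n opt ss0" ..
  have len: "length opt + 1 = fib (n + 2)"
    unfolding opt_def by (rule length_sol)
  have bound: "length opt \<le> length ms" "length ms = length opt \<Longrightarrow> ms = opt"
    if s: "is_solution n ms ss" for ms ss
  proof -
    obtain g where "play n ms (\<lambda>_. PegA) g" "tower n PegC g"
      using s is_solution_iff_play by blast
    moreover have "tower n PegA (\<lambda>_. PegA)"
      by (simp add: tower_def)
    ultimately have "fib (n + 2) \<le> length ms + 1 \<and> (length ms + 1 = fib (n + 2) \<longrightarrow> ms = opt)"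
      using tower_bound_rest_bound[of n] unfolding tower_bound_def opt_def by blast
    then show "length opt \<le> length ms" "length ms = length opt \<Longrightarrow> ms = opt"
      using len by auto
  qed
  have min: "is_minimal_solution n opt ss0"
    using ss0 bound(1) by (simp add: is_minimal_solution_def)
  have opt: "ms = opt" if "is_minimal_solution n ms ss" for ms ss
    using that ss0 bound by (metis is_minimal_solution_def le_antisym)
  have "length ms = fib (n + 2) - 1 \<and> card (set ss) = fib (n + 2)"
    if "is_minimal_solution n ms ss" for ms ss
  proof -
    have "length ss = Suc (length ms)"
      using that by (simp add: is_minimal_solution_def is_solution_def)
    then show ?thesis
      using distinct_card[OF distinct_minimal_solution[OF that]] opt[OF that] len by simp
  qed
  then show ?thesis
    using ss0 min opt by blast
qed

end
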